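(* Let $\mathbb{X}$ be a countably infinite alphabet with a distortion function $\rho:\mathbb{X}\times\mathbb{X}\to[0,\infty)$ satisfying $\rho(x,\bar x)>0$ whenever $\bar x\neq x$, let $\Lambda\subset\mathcal{P}(\mathbb{X})$, and let $d>0$. There exists a $D$-semifaithful coding scheme $\{\xi_n,n\ge 1\}$ operating at distortion $d$ that is strongly minimax universal for $\Lambda$ at distortion $d$, i.e. $$\lim_{n\to\infty}\ \sup_{\mu\in\Lambda}\left[R(\xi_n,\mu^n)-\mathcal{R}_n(d,\mu^n)\right]=0,$$ if and only if there is a sequence $\{\pi_n,n\ge1\}$, with $\pi_n$ a partition of $\mathbb{X}^n$, such that (i) $\pi_n\in\mathcal{Q}_n(d)$ for all $n\ge 1$; (ii) $\displaystyle\lim_{n\to\infty}\frac1n R^+(\Lambda^n,\sigma(\pi_n))=0$; and (iii) $\displaystyle\lim_{n\to\infty}\frac1n\sup_{\mu^n\in\Lambda^n}\left[H_{\sigma(\pi_n)}(\mu^n)-\inf_{\pi\in\mathcal{Q}_n(d)}H_{\sigma(\pi)}(\mu^n)\right]=0$.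
   Context: $\mathcal{P}(S)$ is the set of probability measures on a countable set $S$; $\log$ is base $2$; $\mu^n=\mu\times\cdots\times\mu$ is the $n$-fold product of $\mu\in\mathcal{P}(\mathbb{X})$, and $\Lambda^n=\{\mu^n:\mu\in\Lambda\}$. Single-letter distortion: $\rho_n(x^n,\bar x^n)=\frac1n\sum_{i=1}^n\rho(x_i,\bar x_i)$ for $x^n,\bar x^n\in\mathbb{X}^n$. $D$-semifaithful code of length $n$ operating at distortion $d$: a triplet $\xi_n=(\phi_n,\mathcal{C}_n,\mathcal{D}_n)$, where $\phi_n:\mathbb{X}^n\to\mathcal{B}_n\subset\mathbb{X}^n$ is a quantizer with range $\mathcal{B}_n=\phi_n(\mathbb{X}^n)$ such that $\rho_n(x^n,\phi_n(x^n))\le d$ for every $x^n\in\mathbb{X}^n$ and $y^n\in\phi_n^{-1}(\{y^n\})$ for every $y^n\in\mathcal{B}_n$; $\mathcal{C}_n:\mathcal{B}_n\to\{0,1\}^*=\bigcup_{k\ge1}\{0,1\}^k$ is a prefix-free variable-length binary encoder (so $\sum_{y\in\mathcal{B}_n}2^{-\mathcal{L}(\mathcal{C}_n(y))}\le1$, where $\mathcal{L}$ is the length of a binary string); and $\mathcal{D}_n:\{0,1\}^*\to\mathcal{B}_n$ is the corresponding decoder. A $D$-semifaithful coding scheme operating at distortion $d$ is a sequence $\{\xi_n,n\ge1\}$ of such codes, $\xi_n$ of length $n$. Rate: $R(\xi_n,\mu^n)=\frac1n\mathbb{E}_{X^n\sim\mu^n}\{\mathcal{L}(\mathcal{C}_n(\phi_n(X^n)))\}$.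 Restricted entropy and divergence: for a (countable) partition $\pi$ of $\mathbb{X}^n$ and $\mu,v\in\mathcal{P}(\mathbb{X}^n)$, $$H_{\sigma(\pi)}(\mu)=-\sum_{A\in\pi}\mu(A)\log\mu(A),\qquad D_{\sigma(\pi)}(\mu\|v)=\sum_{A\in\pi}\mu(A)\log\frac{\mu(A)}{v(A)}.$$ $\mathcal{Q}_n(d)$ is the collection of partitions $\pi$ of $\mathbb{X}^n$ such that for every $A\in\pi$ there is $y^n\in A$ with $\sup_{x^n\in A}\rho_n(x^n,y^n)\le d$. Define $\mathcal{R}_n(d,\mu^n)=\inf_{\pi\in\mathcal{Q}_n(d)}\frac1nH_{\sigma(\pi)}(\mu^n)$. Projected information radius: $R^+(\Lambda^n,\sigma(\pi))=\inf_{v\in\mathcal{P}(\mathbb{X}^n)}\sup_{\mu^n\in\Lambda^n}D_{\sigma(\pi)}(\mu^n\|v)$. A limit relation whose terms are suprema of differences is understood to include that, for all large $n$, every difference involved is well defined (not of the form $\infty-\infty$). *)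

theory Defs
  imports "HOL-Probability.Probability" "HOL-Library.Sublist"
begin

text \<open>
  The alphabet is the whole type \<open>'a\<close>, probability measures on a countable set are
  probability mass functions, and the \<open>n\<close>-fold product of \<open>\<mu>\<close> is \<open>replicate_pmf n \<mu>\<close>.
\<close>

definition words :: "nat \<Rightarrow> 'a list set" where
  "words n = {xs. length xs = n}"

definition word_distortion :: "('a \<Rightarrow> 'a \<Rightarrow> real) \<Rightarrow> nat \<Rightarrow> 'a list \<Rightarrow> 'a list \<Rightarrow> real" where
  "word_distortion \<rho> n xs ys = (1 / real n) * (\<Sum>i<n. \<rho> (xs ! i) (ys ! i))"

record 'a code =
  quantizer :: "'a list \<Rightarrow> 'a list"
  encoder :: "'a list \<Rightarrow> bool list"
  decoder :: "bool list \<Rightarrow> 'a list"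

definition codebook :: "nat \<Rightarrow> 'a code \<Rightarrow> 'a list set" where
  "codebook n \<xi> = quantizer \<xi> ` words n"

text \<open>
  Binary strings have length at least one. The functions in the record are total; only their
  values on words of length \<open>n\<close>, on the codebook and on nonempty strings, respectively, matter.
  For \<open>y \<noteq> y'\<close>, the condition \<open>\<not> prefix\<close> gives both injectivity and prefix-freeness.
\<close>

definition semifaithful_code :: "('a \<Rightarrow> 'a \<Rightarrow> real) \<Rightarrow> real \<Rightarrow> nat \<Rightarrow> 'a code \<Rightarrow> bool" where
  "semifaithful_code \<rho> d n \<xi> \<longleftrightarrow>
     codebook n \<xi> \<subseteq> words n \<and>
     (\<forall>x\<in>words n. word_distortion \<rho> n x (quantizer \<xi> x) \<le> d) \<and>
     (\<forall>y\<in>codebook n \<xi>. quantizer \<xi> y = y) \<and>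
     (\<forall>y\<in>codebook n \<xi>. encoder \<xi> y \<noteq> []) \<and>
     (\<forall>y\<in>codebook n \<xi>. \<forall>y'\<in>codebook n \<xi>.
        y \<noteq> y' \<longrightarrow> \<not> prefix (encoder \<xi> y) (encoder \<xi> y')) \<and>
     (\<forall>s. s \<noteq> [] \<longrightarrow> decoder \<xi> s \<in> codebook n \<xi>) \<and>
     (\<forall>y\<in>codebook n \<xi>. decoder \<xi> (encoder \<xi> y) = y)"

definition semifaithful_scheme :: "('a \<Rightarrow> 'a \<Rightarrow> real) \<Rightarrow> real \<Rightarrow> (nat \<Rightarrow> 'a code) \<Rightarrow> bool" where
  "semifaithful_scheme \<rho> d \<xi> \<longleftrightarrow> (\<forall>n\<ge>1. semifaithful_code \<rho> d n (\<xi> n))"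

definition rate :: "nat \<Rightarrow> 'a code \<Rightarrow> 'a list pmf \<Rightarrow> ereal" where
  "rate n \<xi> m = ereal (1 / real n) *
     enn2ereal (\<integral>\<^sup>+x. of_nat (length (encoder \<xi> (quantizer \<xi> x))) \<partial>measure_pmf m)"

definition restricted_entropy :: "'a list set set \<Rightarrow> 'a list pmf \<Rightarrow> ereal" where
  "restricted_entropy P m =
     (\<Sum>\<^sub>\<infinity>A\<in>P. ereal (- (measure_pmf.prob m A * log 2 (measure_pmf.prob m A))))"

text \<open>
  The usual conventions \<open>0 log (0 / q) = 0\<close> and \<open>p log (p / 0) = \<infinity>\<close> for \<open>p > 0\<close>. On a partition
  the negative terms have a finite sum, so the unordered sum in the extended reals exists.
\<close>

definition divergence_term :: "real \<Rightarrow> real \<Rightarrow> ereal" where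
  "divergence_term p q =
     (if p = 0 then 0 else if q = 0 then \<infinity> else ereal (p * log 2 (p / q)))"

definition restricted_divergence ::
  "'a list set set \<Rightarrow> 'a list pmf \<Rightarrow> 'a list pmf \<Rightarrow> ereal" where
  "restricted_divergence P m v =
     (\<Sum>\<^sub>\<infinity>A\<in>P. divergence_term (measure_pmf.prob m A) (measure_pmf.prob v A))"

definition admissible_partitions ::
  "('a \<Rightarrow> 'a \<Rightarrow> real) \<Rightarrow> nat \<Rightarrow> real \<Rightarrow> 'a list set set set" where
  "admissible_partitions \<rho> n d =
     {P. partition_on (words n) P \<and>
         (\<forall>A\<in>P. \<exists>y\<in>A. (SUP x\<in>A. ereal (word_distortion \<rho> n x y)) \<le> ereal d)}"

definition operational_rate ::
  "('a \<Rightarrow> 'a \<Rightarrow> real) \<Rightarrow> nat \<Rightarrow> real \<Rightarrow> 'a list pmf \<Rightarrow> ereal" where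
  "operational_rate \<rho> n d m =
     (INF P\<in>admissible_partitions \<rho> n d. ereal (1 / real n) * restricted_entropy P m)"

definition product_family :: "nat \<Rightarrow> 'a pmf set \<Rightarrow> 'a list pmf set" where
  "product_family n \<Lambda> = replicate_pmf n ` \<Lambda>"

definition projected_radius :: "nat \<Rightarrow> 'a list pmf set \<Rightarrow> 'a list set set \<Rightarrow> ereal" where
  "projected_radius n M P =
     (INF v\<in>{v. set_pmf v \<subseteq> words n}. SUP m\<in>M. restricted_divergence P m v)"

text \<open>
  In type \<open>ereal\<close> the difference \<open>\<infinity> - \<infinity>\<close> has the value \<open>\<infinity>\<close>; this predicate says that
  a difference is not of such an indeterminate form.
\<close>

definition diff_defined :: "ereal \<Rightarrow> ereal \<Rightarrow> bool" where
  "diff_defined a b \<longleftrightarrow> \<not> (a = \<infinity> \<and> b = \<infinity>) \<and> \<not> (a = -\<infinity> \<and> b = -\<infinity>)"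

definition strongly_minimax_universal ::
  "('a \<Rightarrow> 'a \<Rightarrow> real) \<Rightarrow> real \<Rightarrow> 'a pmf set \<Rightarrow> (nat \<Rightarrow> 'a code) \<Rightarrow> bool" where
  "strongly_minimax_universal \<rho> d \<Lambda> \<xi> \<longleftrightarrow>
     (\<forall>\<^sub>F n in sequentially. \<forall>\<mu>\<in>\<Lambda>.
        diff_defined (rate n (\<xi> n) (replicate_pmf n \<mu>))
                     (operational_rate \<rho> n d (replicate_pmf n \<mu>))) \<and>
     (\<lambda>n. SUP \<mu>\<in>\<Lambda>. rate n (\<xi> n) (replicate_pmf n \<mu>)
                    - operational_rate \<rho> n d (replicate_pmf n \<mu>)) \<longlonglongrightarrow> 0"

end

(*
  A code with codeword lengths L(y) and a distribution v on the blocks determine each other up to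
  a bounded number of bits: Kraft's inequality turns 2^(-L) into such a v, and dyadic intervals
  turn -log v, rounded up, into codeword lengths. The expected length with respect to a source m
  exceeds the entropy of the quantizer partition by the divergence of m from v, up to O(1). Since
  the entropy excess and the divergence are both nonnegative, the redundancy over n vanishes
  uniformly iff both contributions, (iii) and (ii), do.
*)
theory Submission
  imports Defs
begin

text \<open>Uniformity comes from the order of quantifiers: a code fixes \<open>v\<close>, and
  \<open>v\<close> together with a partition fixes a code, before any source is seen, so the
  supremum over sources can be taken afterwards. In the direction from partitions to codes the O(1)
  is 4 bits: 2 for rounding to dyadic intervals, 1 for mixing \<open>v\<close> with a geometric
  distribution so that a codeword exists even where \<open>v\<close> vanishes, and 1 because the
  infimum in the radius need not be attained. The obstacle is infinity. Entropies, divergences and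
  expected lengths may be infinite, divergence terms may have either sign, and a difference may have
  the form \<infinity> - \<infinity>. Estimates at fixed n therefore carry
  \<open>diff_defined\<close> along with each bound on differences and assume finite suprema; the
  limits supply these premises only for large n, while a code must exist for every n \<ge>
  1.\<close>

section \<open>Sums and integrals with values in the extended reals\<close>

lemma infsum_ereal_nonneg:
  fixes f :: "'b \<Rightarrow> real"
  assumes nn: "\<And>x. x \<in> A \<Longrightarrow> f x \<ge> 0"
  shows "(\<Sum>\<^sub>\<infinity>x\<in>A. ereal (f x)) = (if f summable_on A then ereal (infsum f A) else \<infinity>)"
proof -
  have eq: "(\<Sum>\<^sub>\<infinity>x\<in>A. ereal (f x)) = (SUP F\<in>{F. finite F \<and> F \<subseteq> A}. ereal (sum f F))"
    by (subst nonneg_infsum_complete) (auto simp: nn)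
  show ?thesis
  proof (cases "f summable_on A")
    case True
    then show ?thesis using eq infsum_nonneg_is_SUPREMUM_ereal[OF True nn] by simp
  next
    case False
    \<comment> \<open>Here the real \<open>infsum\<close> has its default value 0, whereas the
      finite partial sums are unbounded.\<close>
    have "(\<Sum>\<^sub>\<infinity>x\<in>A. ereal (f x)) = \<infinity>"
    proof (rule ereal_top)
      fix B :: real
      have "\<not> bdd_above (sum f ` {F. F \<subseteq> A \<and> finite F})"
        using False nn nonneg_bdd_above_summable_on by blast
      then obtain F where "finite F" "F \<subseteq> A" "sum f F > B"
        unfolding bdd_above_def by (auto simp: not_le)
      then have "ereal B \<le> ereal (sum f F)" by simp
      also have "\<dots> \<le> (SUP F\<in>{F. finite F \<and> F \<subseteq> A}. ereal (sum f F))"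
        using \<open>finite F\<close> \<open>F \<subseteq> A\<close> by (intro SUP_upper) auto
      finally show "ereal B \<le> (\<Sum>\<^sub>\<infinity>x\<in>A. ereal (f x))" using eq by simp
    qed
    then show ?thesis using False by simp
  qed
qed

text \<open>Connects the two languages of the problem: expected code length is a Lebesgue integral,
  entropy and divergence are unordered sums.\<close>

lemma nn_integral_count_space_eq_infsum_ereal:
  fixes f :: "'b \<Rightarrow> real"
  assumes nn: "\<And>x. x \<in> A \<Longrightarrow> f x \<ge> 0"
  shows "enn2ereal (\<integral>\<^sup>+x. ennreal (f x) \<partial>count_space A) = (\<Sum>\<^sub>\<infinity>x\<in>A. ereal (f x))"
proof (cases "f summable_on A")
  case True
  then have "Infinite_Set_Sum.abs_summable_on f A"
    using nn by (subst abs_summable_equivalent[symmetric]) (simp cong: summable_on_cong)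
  then have "(\<integral>\<^sup>+x. ennreal (f x) \<partial>count_space A) = ennreal (infsum f A)"
    using nn nn_integral_conv_infsetsum infsetsum_infsum by metis
  then show ?thesis using True nn by (simp add: infsum_ereal_nonneg infsum_nonneg enn2ereal_ennreal)
next
  case False
  have "(\<integral>\<^sup>+x. ennreal (f x) \<partial>count_space A) = \<infinity>"
  proof (rule ccontr)
    assume "(\<integral>\<^sup>+x. ennreal (f x) \<partial>count_space A) \<noteq> \<infinity>"
    then have "integrable (count_space A) f"
      using nn by (intro integrableI_nonneg) (auto simp: AE_count_space top.not_eq_extremum)
    then have "Infinite_Set_Sum.abs_summable_on f A"
      by (simp add: Infinite_Set_Sum.abs_summable_on_def)
    then show False
      using False nn by (subst (asm) abs_summable_equivalent[symmetric]) (simp cong: summable_on_cong)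
  qed
  then show ?thesis using False nn by (simp add: infsum_ereal_nonneg)
qed

section \<open>The distribution that a source induces on the blocks of a partition\<close>

context
  fixes W :: "'b set" and P :: "'b set set" and m :: "'b pmf" and B :: "'b \<Rightarrow> 'b set"
  assumes P: "partition_on W P" and m: "set_pmf m \<subseteq> W"
  defines "B \<equiv> \<lambda>x. THE A. A \<in> P \<and> x \<in> A"
begin

lemma block_eq: "A \<in> P \<Longrightarrow> x \<in> A \<Longrightarrow> B x = A"
  unfolding B_def using P unfolding partition_on_def disjoint_def by (intro the_equality) auto

lemma pmf_block:
  assumes "A \<in> P"
  shows "pmf (map_pmf B m) A = measure_pmf.prob m A"
proof -
  have "B -` {A} \<inter> set_pmf m = A \<inter> set_pmf m"
    using assms m P block_eq unfolding partition_on_def by blast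
  then show ?thesis unfolding pmf_map by (metis measure_Int_set_pmf)
qed

lemma set_pmf_block: "set_pmf (map_pmf B m) \<subseteq> P"
  using m P block_eq unfolding partition_on_def by fastforce

text \<open>The integrand is constant on blocks, hence factors through the block map
  \<open>B\<close>; the expectation can then be taken under \<open>map_pmf B m\<close>, whose masses
  are the block probabilities.\<close>

lemma nn_integral_blocks:
  fixes f :: "'b \<Rightarrow> nat" and L :: "'b set \<Rightarrow> nat"
  assumes f: "\<And>A x. A \<in> P \<Longrightarrow> x \<in> A \<Longrightarrow> f x = L A"
  shows "enn2ereal (\<integral>\<^sup>+x. of_nat (f x) \<partial>measure_pmf m) =
         (\<Sum>\<^sub>\<infinity>A\<in>P. ereal (measure_pmf.prob m A * real (L A)))"
proof -
  have "(\<integral>\<^sup>+x. of_nat (f x) \<partial>measure_pmf m) = (\<integral>\<^sup>+x. of_nat (L (B x)) \<partial>measure_pmf m)"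
  proof (rule nn_integral_cong_AE, unfold AE_measure_pmf_iff, safe)
    fix x assume "x \<in> set_pmf m"
    then obtain A where "A \<in> P" "x \<in> A" using m P unfolding partition_on_def by blast
    then show "of_nat (f x) = of_nat (L (B x))" using f block_eq by simp
  qed
  also have "\<dots> = (\<integral>\<^sup>+A. of_nat (L A) \<partial>measure_pmf (map_pmf B m))" by simp
  also have "\<dots> = (\<integral>\<^sup>+A. ennreal (pmf (map_pmf B m) A) * of_nat (L A) \<partial>count_space UNIV)"
    by (rule nn_integral_measure_pmf)
  also have "\<dots> = (\<integral>\<^sup>+A. ennreal (pmf (map_pmf B m) A) * of_nat (L A) \<partial>count_space P)"
  proof (rule nn_integral_count_space_eq)
    fix A assume "A \<in> UNIV - P"
    then have "pmf (map_pmf B m) A = 0" using set_pmf_block by (auto simp: pmf_eq_0_set_pmf)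
    then show "ennreal (pmf (map_pmf B m) A) * of_nat (L A) = 0" by simp
  qed simp
  also have "\<dots> = (\<integral>\<^sup>+A. ennreal (measure_pmf.prob m A * real (L A)) \<partial>count_space P)"
    by (intro nn_integral_cong) (simp add: pmf_block ennreal_mult ennreal_of_nat_eq_real_of_nat)
  finally show ?thesis by (simp add: nn_integral_count_space_eq_infsum_ereal)
qed

text \<open>With constant length 1, the block formula for expectations computes the total
  mass.\<close>

lemma has_sum_prob_blocks: "(measure_pmf.prob m has_sum 1) P"
proof -
  have "(\<Sum>\<^sub>\<infinity>A\<in>P. ereal (measure_pmf.prob m A)) = 1"
    using nn_integral_blocks[of "\<lambda>_. 1" "\<lambda>_. 1"] by (simp add: one_ennreal.rep_eq)
  then show ?thesis
    by (subst (asm) infsum_ereal_nonneg) (auto split: if_splits simp: has_sum_iff)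
qed

end

section \<open>Entropy, divergence and cross entropy on a countable family\<close>

text \<open>
  The summand \<open>(q - p) / ln 2\<close> makes every term nonnegative and has total \<open>0\<close> over a partition, so
  the sum of the possibly negative or infinite divergence terms becomes one of nonnegative terms.
\<close>

lemma compensated_divergence_term_nonneg:
  assumes "p \<ge> 0" "q \<ge> 0"
  shows "0 \<le> divergence_term p q + ereal ((q - p) / ln 2)"
proof (cases "p = 0 \<or> q = 0")
  case True
  then show ?thesis using assms by (auto simp: divergence_term_def zero_ereal_def)
next
  case False
  then have pos: "p > 0" "q > 0" using assms by auto
  have "ln (q / p) \<le> q / p - 1" using pos by (intro ln_le_minus_one) simp
  then have "p * ln (q / p) \<le> p * (q / p - 1)" using pos by (intro mult_left_mono) auto
  also have "\<dots> = q - p" using pos by (simp add: field_simps)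
  finally have "0 \<le> p * ln (p / q) + (q - p)" using pos by (simp add: ln_div algebra_simps)
  then have "0 \<le> (p * ln (p / q) + (q - p)) / ln 2" by simp
  then show ?thesis using False by (simp add: divergence_term_def log_def add_divide_distrib)
qed

context
  fixes p q :: "'b \<Rightarrow> real" and P :: "'b set"
  assumes p: "(p has_sum 1) P" and q: "(q has_sum 1) P"
    and p_nn: "\<And>A. A \<in> P \<Longrightarrow> p A \<ge> 0" and q_nn: "\<And>A. A \<in> P \<Longrightarrow> q A \<ge> 0"
begin

lemma has_sum_diff_distribution: "((\<lambda>A. (p A - q A) / ln 2) has_sum 0) P"
  using has_sum_cmult_left[OF has_sum_add[OF p has_sum_uminusI[OF q]], of "1 / ln 2"] by simp

text \<open>The total may be \<infinity>, so the argument runs through limits of finite partial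
  sums: those of the correction tend to the finite value 0, and addition is continuous when one
  limit is finite.\<close>

lemma infsum_divergence_term:
  "(\<Sum>\<^sub>\<infinity>A\<in>P. divergence_term (p A) (q A)) =
   (\<Sum>\<^sub>\<infinity>A\<in>P. divergence_term (p A) (q A) + ereal ((q A - p A) / ln 2))"
proof -
  define g where "g A = divergence_term (p A) (q A) + ereal ((q A - p A) / ln 2)" for A
  define r where "r A = (p A - q A) / ln 2" for A
  have "g summable_on P"
    by (rule nonneg_summable_on_complete) (simp add: g_def compensated_divergence_term_nonneg p_nn q_nn)
  then have g: "(sum g \<longlongrightarrow> infsum g P) (finite_subsets_at_top P)"
    using has_sum_def by (metis has_sum_infsum)
  have "(sum r \<longlongrightarrow> 0) (finite_subsets_at_top P)"
    using has_sum_diff_distribution unfolding r_def has_sum_def .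
  then have r: "((\<lambda>F. ereal (sum r F)) \<longlongrightarrow> 0) (finite_subsets_at_top P)"
    by (simp add: zero_ereal_def)
  have "((\<lambda>F. sum g F + ereal (sum r F)) \<longlongrightarrow> infsum g P + 0) (finite_subsets_at_top P)"
    by (rule tendsto_add_ereal_general1[OF _ g r]) simp
  moreover have "sum g F + ereal (sum r F) = (\<Sum>A\<in>F. divergence_term (p A) (q A))" for F
  proof -
    have "g A + ereal (r A) = divergence_term (p A) (q A)" for A
      by (cases "divergence_term (p A) (q A)") (auto simp: g_def r_def diff_divide_distrib)
    then show ?thesis unfolding sum_ereal[symmetric] sum.distrib[symmetric] by simp
  qed
  ultimately have "((\<lambda>A. divergence_term (p A) (q A)) has_sum infsum g P) P"
    unfolding has_sum_def by simp
  then show ?thesis unfolding g_def[symmetric] by (rule infsumI)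
qed

text \<open>Gibbs' inequality, read off term by term after the compensation.\<close>

lemma infsum_divergence_term_nonneg: "0 \<le> (\<Sum>\<^sub>\<infinity>A\<in>P. divergence_term (p A) (q A))"
  unfolding infsum_divergence_term
  by (rule infsum_nonneg) (simp add: compensated_divergence_term_nonneg p_nn q_nn)

lemma entropy_term_nonneg: "A \<in> P \<Longrightarrow> 0 \<le> - (p A * log 2 (p A))"
proof -
  assume A: "A \<in> P"
  have "sum p {A} \<le> 1" using A p p_nn by (intro finite_sum_le_has_sum[of p]) auto
  then have "p A \<le> 1" by simp
  then show ?thesis
    using p_nn[OF A] by (cases "p A = 0") (auto simp: mult_le_0_iff)
qed

text \<open>Termwise, entropy and divergence add up to the cross entropy
  \<open>- (p A * log 2 (q A))\<close>, which \<open>t\<close> dominates. The family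
  \<open>u\<close> differs from \<open>t\<close> by a family of total 0, so it keeps the sum of
  \<open>t\<close>; dominating \<open>h + g\<close> with both parts nonnegative, it forces each of
  them to be summable. If \<open>t\<close> is not summable, the right side is \<infinity>.\<close>

lemma entropy_plus_divergence_le:
  assumes t: "\<And>A. A \<in> P \<Longrightarrow> 0 \<le> t A"
    and pq: "\<And>A. A \<in> P \<Longrightarrow> p A > 0 \<Longrightarrow> q A > 0 \<and> - (p A * log 2 (q A)) \<le> t A"
  shows "(\<Sum>\<^sub>\<infinity>A\<in>P. ereal (- (p A * log 2 (p A)))) + (\<Sum>\<^sub>\<infinity>A\<in>P. divergence_term (p A) (q A))
         \<le> (\<Sum>\<^sub>\<infinity>A\<in>P. ereal (t A))"
proof (cases "t summable_on P")
  case False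
  then show ?thesis by (simp add: infsum_ereal_nonneg t)
next
  case True
  define h where "h A = - (p A * log 2 (p A))" for A
  define g where "g A = (if p A = 0 then 0 else p A * log 2 (p A / q A)) + (q A - p A) / ln 2" for A
  define u where "u A = t A - (p A - q A) / ln 2" for A
  have g_eq: "divergence_term (p A) (q A) + ereal ((q A - p A) / ln 2) = ereal (g A)" if "A \<in> P" for A
    using p_nn[OF that] pq[OF that]
    by (cases "p A = 0") (auto simp: g_def divergence_term_def)
  have g_nn: "0 \<le> g A" if "A \<in> P" for A
    using compensated_divergence_term_nonneg[OF p_nn q_nn, OF that that] g_eq[OF that] by simp
  have h_nn: "0 \<le> h A" if "A \<in> P" for A
    using entropy_term_nonneg[OF that] by (simp add: h_def)
  have le: "h A + g A \<le> u A" if "A \<in> P" for A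
  proof (cases "p A = 0")
    case True
    then show ?thesis using t[OF that] by (simp add: h_def g_def u_def diff_divide_distrib)
  next
    case False
    then have "p A > 0" using p_nn[OF that] by simp
    then show ?thesis using pq[OF that]
      by (simp add: h_def g_def u_def diff_divide_distrib log_divide algebra_simps)
  qed
  have "(u has_sum (infsum t P + - 0)) P"
    unfolding u_def diff_conv_add_uminus[of "t _"] using True has_sum_diff_distribution
    by (intro has_sum_add has_sum_uminusI) auto
  then have u: "u summable_on P" "infsum u P = infsum t P"
    by (auto simp: has_sum_iff)
  have h: "h summable_on P"
    by (rule summable_on_comparison_test[OF u(1)]) (use le g_nn h_nn in fastforce)+
  have g: "g summable_on P"
    by (rule summable_on_comparison_test[OF u(1)]) (use le g_nn h_nn in fastforce)+
  have "infsum h P + infsum g P = infsum (\<lambda>A. h A + g A) P"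
    using h g by (simp add: infsum_add)
  also have "\<dots> \<le> infsum u P"
    by (rule infsum_mono) (use h g u le summable_on_add in auto)
  finally have "infsum h P + infsum g P \<le> infsum t P" using u by simp
  moreover have "(\<Sum>\<^sub>\<infinity>A\<in>P. divergence_term (p A) (q A)) = ereal (infsum g P)"
    unfolding infsum_divergence_term
    using infsum_cong[OF g_eq, of P] g g_nn by (simp add: infsum_ereal_nonneg)
  moreover have "(\<Sum>\<^sub>\<infinity>A\<in>P. ereal (- (p A * log 2 (p A)))) = ereal (infsum h P)"
    using h h_nn infsum_ereal_nonneg[of P h] unfolding h_def by simp
  moreover have "(\<Sum>\<^sub>\<infinity>A\<in>P. ereal (t A)) = ereal (infsum t P)"
    using True t by (simp add: infsum_ereal_nonneg)
  ultimately show ?thesis by simp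
qed

text \<open>Only finite entropy and divergence need an argument, and then every term is real. In
  \<open>u\<close> the compensation cancels, and the term \<open>c * p A\<close> contributes exactly
  \<open>c\<close> because \<open>p\<close> has total 1.\<close>

lemma le_entropy_plus_divergence:
  assumes t: "\<And>A. A \<in> P \<Longrightarrow> 0 \<le> t A" and t0: "\<And>A. A \<in> P \<Longrightarrow> p A = 0 \<Longrightarrow> t A = 0"
    and pq: "\<And>A. A \<in> P \<Longrightarrow> p A > 0 \<Longrightarrow> q A > 0 \<Longrightarrow> t A \<le> - (p A * log 2 (q A)) + c * p A"
  shows "(\<Sum>\<^sub>\<infinity>A\<in>P. ereal (t A)) \<le>
         (\<Sum>\<^sub>\<infinity>A\<in>P. ereal (- (p A * log 2 (p A)))) + (\<Sum>\<^sub>\<infinity>A\<in>P. divergence_term (p A) (q A)) + ereal c"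
    (is "_ \<le> ?H + ?D + _")
proof (cases "?H = \<infinity> \<or> ?D = \<infinity>")
  case True
  moreover have "?H \<ge> 0" by (rule infsum_nonneg) (use entropy_term_nonneg in simp)
  moreover have "?D \<ge> 0" by (rule infsum_divergence_term_nonneg)
  ultimately have "?H + ?D + ereal c = \<infinity>" by auto
  then show ?thesis by (metis ereal_less_eq(1))
next
  case False
  define h where "h A = - (p A * log 2 (p A))" for A
  define G where "G A = divergence_term (p A) (q A) + ereal ((q A - p A) / ln 2)" for A
  define g where "g A = (if p A = 0 then 0 else p A * log 2 (p A / q A)) + (q A - p A) / ln 2" for A
  have G_nn: "0 \<le> G A" if "A \<in> P" for A
    unfolding G_def using compensated_divergence_term_nonneg[OF p_nn q_nn, OF that that] .
  \<comment> \<open>Finite divergence forces absolute continuity: a single infinite term among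
    nonnegative compensated terms would already make the sum infinite.\<close>
  have q_pos: "q A > 0" if "A \<in> P" "p A > 0" for A
  proof (rule ccontr)
    assume "\<not> q A > 0"
    then have "G A = \<infinity>" using that q_nn[OF that(1)] by (simp add: G_def divergence_term_def)
    moreover have "sum G {A} \<le> (SUP F\<in>{F. finite F \<and> F \<subseteq> P}. sum G F)"
      using that by (intro SUP_upper) auto
    then have "G A \<le> infsum G P" using G_nn by (simp add: nonneg_infsum_complete)
    ultimately show False using False infsum_divergence_term unfolding G_def by simp
  qed
  have g_eq: "G A = ereal (g A)" if "A \<in> P" for A
    using p_nn[OF that] q_pos[OF that]
    by (cases "p A = 0") (auto simp: G_def g_def divergence_term_def)
  have g_nn: "0 \<le> g A" if "A \<in> P" for A using G_nn[OF that] g_eq[OF that] by simp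
  have h_nn: "0 \<le> h A" if "A \<in> P" for A
    using entropy_term_nonneg[OF that] by (simp add: h_def)
  have D: "?D = (\<Sum>\<^sub>\<infinity>A\<in>P. ereal (g A))"
    unfolding infsum_divergence_term using infsum_cong[OF g_eq, of P] by (simp add: G_def)
  have H: "?H = (\<Sum>\<^sub>\<infinity>A\<in>P. ereal (h A))" by (simp add: h_def)
  have h: "h summable_on P" and g: "g summable_on P"
    using False unfolding D H by (auto simp: infsum_ereal_nonneg h_nn g_nn split: if_splits)
  define u where "u A = h A + g A + (p A - q A) / ln 2 + c * p A" for A
  have u: "(u has_sum (infsum h P + infsum g P + 0 + c * 1)) P"
    unfolding u_def using h g has_sum_diff_distribution p
    by (intro has_sum_add has_sum_cmult_right) auto
  have le: "t A \<le> u A" if "A \<in> P" for A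
  proof (cases "p A = 0")
    case True
    then show ?thesis using t0[OF that] by (simp add: h_def g_def u_def diff_divide_distrib)
  next
    case False
    then have "p A > 0" using p_nn[OF that] by simp
    then show ?thesis using pq[OF that] q_pos[OF that]
      by (simp add: h_def g_def u_def diff_divide_distrib log_divide algebra_simps)
  qed
  have ts: "t summable_on P"
    using u by (intro summable_on_comparison_test[of u P t]) (auto simp: le t has_sum_iff)
  have "infsum t P \<le> infsum u P" using ts u le by (intro infsum_mono) (auto simp: has_sum_iff)
  also have "\<dots> = infsum h P + infsum g P + c" using u by (simp add: has_sum_iff)
  finally show ?thesis unfolding D H using ts h g by (simp add: infsum_ereal_nonneg h_nn g_nn t)
qed

end

section \<open>Kraft's inequality and the construction of prefix codes\<close>

text \<open>Extend each codeword in all ways to a common length \<open>N\<close>. Two codewords with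
  a common extension are comparable as prefixes, so the sets of extensions are disjoint inside the
  \<open>2 ^ N\<close> words of that length. The sum of all lengths serves as a crude common bound
  \<open>N\<close>.\<close>

lemma kraft_inequality_finite:
  fixes c :: "'b \<Rightarrow> bool list"
  assumes "finite F" and pf: "\<And>x y. x \<in> F \<Longrightarrow> y \<in> F \<Longrightarrow> x \<noteq> y \<Longrightarrow> \<not> prefix (c x) (c y)"
  shows "(\<Sum>x\<in>F. (1/2::real) ^ length (c x)) \<le> 1"
proof -
  define N where "N = (\<Sum>x\<in>F. length (c x))"
  have le: "length (c x) \<le> N" if "x \<in> F" for x
    unfolding N_def using that assms(1) by (intro member_le_sum) auto
  define E where "E x = (\<lambda>z. c x @ z) ` {z :: bool list. length z = N - length (c x)}" for x
  have card_lists: "card {z :: bool list. length z = k} = 2 ^ k" for k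
    using card_lists_length_eq[of "UNIV :: bool set" k] by simp
  have fin_lists: "finite {z :: bool list. length z = k}" for k
    using finite_lists_length_eq[of "UNIV :: bool set" k] by simp
  have card_E: "card (E x) = 2 ^ (N - length (c x))" for x
    unfolding E_def by (subst card_image) (auto simp: card_lists inj_on_def)
  have fin_E: "finite (E x)" for x by (simp add: E_def fin_lists)
  have disj: "E x \<inter> E y = {}" if "x \<in> F" "y \<in> F" "x \<noteq> y" for x y
  proof (rule ccontr)
    assume "E x \<inter> E y \<noteq> {}"
    then obtain u v where "c x @ u = c y @ v" unfolding E_def by auto
    then have "prefix (c x) (c x @ u)" "prefix (c y) (c x @ u)"
      by (blast intro: prefixI)+
    then show False using prefix_same_cases pf that by metis
  qed
  have "(\<Sum>x\<in>F. (2::nat) ^ (N - length (c x))) = card (\<Union>x\<in>F. E x)"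
    using assms(1) disj by (subst card_UN_disjoint) (auto simp: card_E fin_E)
  also have "\<dots> \<le> card {z :: bool list. length z = N}"
    using le by (intro card_mono fin_lists) (auto simp: E_def)
  finally have "(\<Sum>x\<in>F. (2::nat) ^ (N - length (c x))) \<le> 2 ^ N" by (simp add: card_lists)
  then have "real (\<Sum>x\<in>F. (2::nat) ^ (N - length (c x))) \<le> real (2 ^ N)" by (simp only: of_nat_le_iff)
  then have "(\<Sum>x\<in>F. (2::real) ^ (N - length (c x))) \<le> 2 ^ N" by simp
  moreover have "(\<Sum>x\<in>F. (2::real) ^ (N - length (c x))) = 2 ^ N * (\<Sum>x\<in>F. (1/2::real) ^ length (c x))"
    unfolding sum_distrib_left by (intro sum.cong) (auto simp: le power_diff power_one_over field_simps)
  ultimately show ?thesis by simp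
qed

text \<open>The most significant bit comes first, so \<open>w\<close> names the dyadic interval from
  \<open>bits_value w / 2 ^ length w\<close> to \<open>(bits_value w + 1) / 2 ^ length w\<close>,
  and appending bits selects a subinterval.\<close>

fun bits_value :: "bool list \<Rightarrow> nat" where
  "bits_value [] = 0"
| "bits_value (b # bs) = of_bool b * 2 ^ length bs + bits_value bs"

lemma bits_value_less: "bits_value bs < 2 ^ length bs"
  by (induction bs) auto

lemma bits_value_append: "bits_value (xs @ ys) = bits_value xs * 2 ^ length ys + bits_value ys"
  by (induction xs) (auto simp: algebra_simps power_add)

lemma ex_bits_value: "k < 2 ^ L \<Longrightarrow> \<exists>w. length w = L \<and> bits_value w = k"
proof (induction L arbitrary: k)
  case 0
  then show ?case by simp
next
  case (Suc L)
  obtain w where "length w = L" "bits_value w = k mod 2 ^ L" using Suc.IH[of "k mod 2 ^ L"] by auto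
  moreover have "k div 2 ^ L < 2" using Suc.prems by (simp add: less_mult_imp_div_less)
  then have "of_bool (k div 2 ^ L = 1) = k div 2 ^ L" by (auto simp: less_2_cases_iff)
  ultimately have "length ((k div 2 ^ L = 1) # w) = Suc L \<and> bits_value ((k div 2 ^ L = 1) # w) = k"
    using div_mult_mod_eq[of k "2 ^ L"] by simp
  then show ?case by blast
qed

text \<open>
  The codeword of \<open>i\<close> names a dyadic interval of length at least \<open>q i / 4\<close> inside the \<open>i\<close>-th of
  the consecutive intervals of lengths \<open>q 0, q 1, \<dots>\<close>; disjoint dyadic intervals have
  incomparable names.
\<close>

lemma ex_prefix_code:
  fixes q :: "nat \<Rightarrow> real"
  assumes pos: "\<And>i. q i > 0" and le1: "\<And>k. (\<Sum>i<k. q i) \<le> 1"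
  shows "\<exists>c :: nat \<Rightarrow> bool list. (\<forall>i. c i \<noteq> []) \<and>
    (\<forall>i j. i \<noteq> j \<longrightarrow> \<not> prefix (c i) (c j)) \<and> (\<forall>i. real (length (c i)) \<le> - log 2 (q i) + 2)"
proof -
  define S where "S k = (\<Sum>i<k. q i)" for k
  have S_Suc: "S (Suc k) = S k + q k" for k by (simp add: S_def)
  have S_mono: "S i \<le> S j" if "i \<le> j" for i j
    unfolding S_def using that pos by (intro sum_mono2) (auto simp: less_imp_le)
  have S_nn: "0 \<le> S k" for k unfolding S_def by (intro sum_nonneg) (simp add: less_imp_le pos)
  \<comment> \<open>The extra bit makes the dyadic interval at most half as long as
    \<open>q i\<close>, which leaves room for rounding its left end up to the grid.\<close>
  define L where "L i = nat \<lceil>- log 2 (q i)\<rceil> + 1" for i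
  have q_le: "q i \<le> 1" for i using le1[of "Suc i"] S_nn[of i] by (simp add: S_def)
  have log_nn: "0 \<le> - log 2 (q i)" for i using q_le[of i] pos[of i] by simp
  have L_le: "real (L i) \<le> - log 2 (q i) + 2" for i
    unfolding L_def using log_nn[of i] by simp linarith
  have L_ge: "2 * (1/2) ^ L i \<le> q i" for i
  proof -
    have "- log 2 (q i) \<le> real (nat \<lceil>- log 2 (q i)\<rceil>)" by linarith
    then have "2 powr (- real (nat \<lceil>- log 2 (q i)\<rceil>)) \<le> 2 powr (log 2 (q i))"
      by (intro powr_mono) auto
    then show ?thesis using pos[of i]
      by (simp add: L_def powr_minus powr_realpow power_one_over inverse_eq_divide)
  qed
  define k where "k i = nat \<lceil>S i * 2 ^ L i\<rceil>" for i
  have k_ge: "S i * 2 ^ L i \<le> real (k i)" and k_less: "real (k i) < S i * 2 ^ L i + 1" for i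
    using S_nn[of i] unfolding k_def by (auto simp: zero_le_mult_iff intro: of_nat_ceiling) linarith
  have k_Suc: "real (k i) + 1 \<le> S (Suc i) * 2 ^ L i" for i
  proof -
    have "2 * (1/2) ^ L i * 2 ^ L i \<le> q i * 2 ^ L i" by (intro mult_right_mono L_ge) simp
    then have "2 \<le> q i * 2 ^ L i" by (simp add: power_one_over)
    then show ?thesis using k_less[of i] by (simp add: S_Suc algebra_simps)
  qed
  have "k i < 2 ^ L i" for i
  proof -
    have "S (Suc i) * 2 ^ L i \<le> 1 * 2 ^ L i" unfolding S_def by (intro mult_right_mono le1) simp
    then have "real (k i) < 2 ^ L i" using k_Suc[of i] by linarith
    then show ?thesis by (metis of_nat_less_iff of_nat_numeral of_nat_power)
  qed
  then have "\<forall>i. \<exists>w. length w = L i \<and> bits_value w = k i" using ex_bits_value by blast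
  then obtain c where c: "\<And>i. length (c i) = L i" "\<And>i. bits_value (c i) = k i" by metis
  have pf: "\<not> prefix (c i) (c j)" if "i \<noteq> j" for i j
  proof
    assume "prefix (c i) (c j)"
    then obtain z where z: "c j = c i @ z" by (auto simp: prefix_def)
    have L: "L j = L i + length z" using arg_cong[OF z, of length] c by simp
    have v: "k j = k i * 2 ^ length z + bits_value z"
      using arg_cong[OF z, of bits_value] c by (simp add: bits_value_append)
    have lb: "real (k i) * 2 ^ length z \<le> real (k j)" using v by simp
    have "k j + 1 \<le> (k i + 1) * 2 ^ length z" using v bits_value_less[of z] by simp
    then have "real (k j + 1) \<le> real ((k i + 1) * 2 ^ length z)" by (simp only: of_nat_le_iff)
    then have ub: "real (k j) + 1 \<le> (real (k i) + 1) * 2 ^ length z"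
      by (simp add: algebra_simps)
    \<comment> \<open>A prefix relation nests the dyadic interval of \<open>j\<close> in that of
      \<open>i\<close>. Each lies in its own interval of the partial sums \<open>S\<close>, so those
      two would overlap, contradicting monotonicity of \<open>S\<close>.\<close>
    have "S i * 2 ^ L j \<le> real (k i) * 2 ^ length z"
      using mult_right_mono[OF k_ge[of i], of "2 ^ length z"] by (simp add: L power_add mult.assoc)
    also note lb
    also have "real (k j) < S (Suc j) * 2 ^ L j" using k_Suc[of j] by simp
    finally have ij: "S i < S (Suc j)" by simp
    have "S j * 2 ^ L j \<le> real (k j)" by (rule k_ge)
    also have "\<dots> < (real (k i) + 1) * 2 ^ length z" using ub by simp
    also have "\<dots> \<le> S (Suc i) * 2 ^ L j"
      using mult_right_mono[OF k_Suc[of i], of "2 ^ length z"] by (simp add: L power_add mult.assoc)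
    finally have "S j < S (Suc i)" by simp
    with ij show False
      using S_mono[of "Suc i" j] S_mono[of "Suc j" i] \<open>i \<noteq> j\<close> by (cases "i < j") auto
  qed
  have "c i \<noteq> []" for i using c(1)[of i] by (auto simp: L_def)
  then show ?thesis using pf L_le c by metis
qed

lemma kraft_inequality:
  fixes c :: "'b \<Rightarrow> bool list"
  assumes pf: "\<And>x y. x \<in> Y \<Longrightarrow> y \<in> Y \<Longrightarrow> x \<noteq> y \<Longrightarrow> \<not> prefix (c x) (c y)"
  shows "(\<lambda>y. (1/2::real) ^ length (c y)) summable_on Y"
    and "(\<Sum>\<^sub>\<infinity>y\<in>Y. (1/2::real) ^ length (c y)) \<le> 1"
proof -
  have le: "(\<Sum>y\<in>F. (1/2::real) ^ length (c y)) \<le> 1" if "finite F" "F \<subseteq> Y" for F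
    using that pf by (intro kraft_inequality_finite) auto
  show 1: "(\<lambda>y. (1/2::real) ^ length (c y)) summable_on Y"
    using le by (intro nonneg_bdd_above_summable_on bdd_aboveI[of _ 1]) auto
  show "(\<Sum>\<^sub>\<infinity>y\<in>Y. (1/2::real) ^ length (c y)) \<le> 1"
    by (rule infsum_le_finite_sums[OF 1]) (use le in auto)
qed

section \<open>Codes and reference distributions at a fixed block length\<close>

text \<open>Needed because the Kraft sum of a code may be less than 1, so that its weights become a
  distribution only after normalization.\<close>

lemma ex_pmf_proportional:
  fixes w :: "'b \<Rightarrow> real"
  assumes w: "w summable_on Y" "\<And>y. y \<in> Y \<Longrightarrow> 0 \<le> w y" and K: "infsum w Y > 0"
  shows "\<exists>v. set_pmf v \<subseteq> Y \<and> (\<forall>y\<in>Y. pmf v y = w y / infsum w Y)"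
proof -
  define f where "f y = (if y \<in> Y then w y / infsum w Y else 0)" for y
  have nn: "0 \<le> f y" for y using w(2) K by (simp add: f_def)
  have "(w has_sum infsum w Y) Y" using w(1) by (rule has_sum_infsum)
  from has_sum_cmult_left[OF this, of "1 / infsum w Y"]
  have hs: "((\<lambda>y. w y / infsum w Y) has_sum 1) Y" using K by simp
  then have "(f has_sum 1) Y"
    by (subst has_sum_cong[of _ _ "\<lambda>y. w y / infsum w Y"]) (auto simp: f_def)
  then have "enn2ereal (\<integral>\<^sup>+y. ennreal (f y) \<partial>count_space Y) = 1"
    using nn by (simp add: nn_integral_count_space_eq_infsum_ereal infsum_ereal_nonneg has_sum_iff
        one_ereal_def)
  then have "(\<integral>\<^sup>+y. ennreal (f y) \<partial>count_space Y) = 1"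
    by (metis enn2ereal_inject one_ennreal.rep_eq)
  moreover have "(\<integral>\<^sup>+y. ennreal (f y) \<partial>count_space UNIV) = (\<integral>\<^sup>+y. ennreal (f y) \<partial>count_space Y)"
    by (rule nn_integral_count_space_eq) (auto simp: f_def)
  ultimately have 1: "(\<integral>\<^sup>+y. ennreal (f y) \<partial>count_space UNIV) = 1" by simp
  have "set_pmf (embed_pmf f) \<subseteq> Y" using nn 1 by (auto simp: set_embed_pmf f_def)
  moreover have "\<forall>y\<in>Y. pmf (embed_pmf f) y = w y / infsum w Y"
    using nn 1 by (simp add: pmf_embed_pmf) (simp add: f_def)
  ultimately show ?thesis by blast
qed

definition expected_length :: "'a code \<Rightarrow> 'a list pmf \<Rightarrow> ereal" where
  "expected_length \<xi> m =
     enn2ereal (\<integral>\<^sup>+x. of_nat (length (encoder \<xi> (quantizer \<xi> x))) \<partial>measure_pmf m)"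

text \<open>Indexing the fibres by the codebook keeps them nonempty, as a partition
  requires.\<close>

definition quantizer_partition :: "nat \<Rightarrow> 'a code \<Rightarrow> 'a list set set" where
  "quantizer_partition n \<xi> = (\<lambda>y. {x \<in> words n. quantizer \<xi> x = y}) ` codebook n \<xi>"

lemma restricted_entropy_nonneg:
  assumes "partition_on (words n) P" "set_pmf m \<subseteq> words n"
  shows "0 \<le> restricted_entropy P m"
  unfolding restricted_entropy_def
  using entropy_term_nonneg[OF has_sum_prob_blocks[OF assms] has_sum_prob_blocks[OF assms]]
  by (intro infsum_nonneg) simp

lemma restricted_divergence_nonneg:
  assumes "partition_on (words n) P" "set_pmf m \<subseteq> words n" "set_pmf v \<subseteq> words n"
  shows "0 \<le> restricted_divergence P m v"
  unfolding restricted_divergence_def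
  using assms by (intro infsum_divergence_term_nonneg has_sum_prob_blocks) auto

lemma partition_on_quantizer_partition: "partition_on (words n) (quantizer_partition n \<xi>)"
  unfolding partition_on_def quantizer_partition_def disjoint_def codebook_def by auto

text \<open>The quantizer fixes its codewords, so each one lies in its own fibre and can serve as
  the centre there.\<close>

lemma quantizer_partition_admissible:
  assumes "semifaithful_code \<rho> d n \<xi>"
  shows "quantizer_partition n \<xi> \<in> admissible_partitions \<rho> n d"
  unfolding admissible_partitions_def
proof (safe intro!: partition_on_quantizer_partition)
  fix A assume "A \<in> quantizer_partition n \<xi>"
  then obtain y where y: "y \<in> codebook n \<xi>" "A = {x \<in> words n. quantizer \<xi> x = y}"
    unfolding quantizer_partition_def by auto
  then have "y \<in> A" using assms unfolding semifaithful_code_def by auto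
  moreover have "(SUP x\<in>A. ereal (word_distortion \<rho> n x y)) \<le> ereal d"
    using assms y unfolding semifaithful_code_def by (intro SUP_least) auto
  ultimately show "\<exists>y\<in>A. (SUP x\<in>A. ereal (word_distortion \<rho> n x y)) \<le> ereal d" by blast
qed

text \<open>\<open>v\<close> is the normalized Kraft distribution placed on the codewords. It
  depends on the code alone, which is what a bound on the radius by a supremum over sources
  demands.\<close>

lemma entropy_plus_divergence_le_expected_length:
  assumes \<xi>: "semifaithful_code \<rho> d n \<xi>"
  shows "\<exists>v. set_pmf v \<subseteq> words n \<and> (\<forall>m. set_pmf m \<subseteq> words n \<longrightarrow>
    restricted_entropy (quantizer_partition n \<xi>) m
      + restricted_divergence (quantizer_partition n \<xi>) m v \<le> expected_length \<xi> m)"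
proof -
  define Y where "Y = codebook n \<xi>"
  define P where "P = quantizer_partition n \<xi>"
  define w :: "'a list \<Rightarrow> real" where "w y = (1/2) ^ length (encoder \<xi> y)" for y
  define K where "K = infsum w Y"
  have Y: "Y \<subseteq> words n" and idem: "\<And>y. y \<in> Y \<Longrightarrow> quantizer \<xi> y = y"
    and pf: "\<And>x y. x \<in> Y \<Longrightarrow> y \<in> Y \<Longrightarrow> x \<noteq> y \<Longrightarrow> \<not> prefix (encoder \<xi> x) (encoder \<xi> y)"
    using \<xi> unfolding semifaithful_code_def Y_def by auto
  have w: "w summable_on Y" "K \<le> 1"
    unfolding w_def K_def using kraft_inequality[of Y "encoder \<xi>"] pf by auto
  have "replicate n undefined \<in> words n" by (simp add: words_def)
  then obtain y0 where y0: "y0 \<in> Y" unfolding Y_def codebook_def by blast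
  have "sum w {y0} \<le> K"
    unfolding K_def using w y0 by (intro finite_sum_le_has_sum[of w]) (auto simp: w_def)
  moreover have "w y0 > 0" by (simp add: w_def)
  ultimately have K: "K > 0" by simp
  obtain v where v: "set_pmf v \<subseteq> Y" "\<And>y. y \<in> Y \<Longrightarrow> pmf v y = w y / K"
    using ex_pmf_proportional[of w Y] w K unfolding K_def by (auto simp: w_def)
  define L where "L A = length (encoder \<xi> (quantizer \<xi> (SOME x. x \<in> A)))" for A
  have L: "length (encoder \<xi> (quantizer \<xi> x)) = L A" if "A \<in> P" "x \<in> A" for A x
  proof -
    have "(SOME x. x \<in> A) \<in> A" using that(2) by (rule someI)
    then show ?thesis using that unfolding L_def P_def quantizer_partition_def by auto
  qed
  have part: "partition_on (words n) P"
    unfolding P_def by (rule partition_on_quantizer_partition)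
  have prob_v: "measure_pmf.prob v A = (1/2) ^ L A / K" if A: "A \<in> P" for A
  proof -
    obtain y where y: "y \<in> Y" "A = {x \<in> words n. quantizer \<xi> x = y}"
      using A unfolding P_def quantizer_partition_def Y_def by blast
    have "y \<in> A" using y Y idem by auto
    have "pmf v y > 0" using v(2) y(1) K by (simp add: w_def)
    then have "A \<inter> set_pmf v = {y}"
      using v(1) y Y idem \<open>y \<in> A\<close> by (auto simp: pmf_positive_iff)
    then have "measure_pmf.prob v A = pmf v y"
      by (metis measure_Int_set_pmf measure_pmf_single)
    then show ?thesis using v(2) y(1) L[OF A \<open>y \<in> A\<close>] idem by (simp add: w_def)
  qed
  have "restricted_entropy P m + restricted_divergence P m v \<le> expected_length \<xi> m"
    if m: "set_pmf m \<subseteq> words n" for m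
  proof -
    have "expected_length \<xi> m = (\<Sum>\<^sub>\<infinity>A\<in>P. ereal (measure_pmf.prob m A * real (L A)))"
      unfolding expected_length_def by (rule nn_integral_blocks[OF part m]) (simp add: L)
    moreover have "restricted_entropy P m + restricted_divergence P m v
        \<le> (\<Sum>\<^sub>\<infinity>A\<in>P. ereal (measure_pmf.prob m A * real (L A)))"
      unfolding restricted_entropy_def restricted_divergence_def
    proof (rule entropy_plus_divergence_le)
      show "(measure_pmf.prob m has_sum 1) P" "(measure_pmf.prob v has_sum 1) P"
        using part m order_trans[OF v(1) Y] by (auto intro: has_sum_prob_blocks)
      fix A assume A: "A \<in> P" "measure_pmf.prob m A > 0"
      \<comment> \<open>Normalization works in the right direction: \<open>K\<close> is at most 1,
        so dividing by it only raises the probabilities.\<close>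
      have "log 2 (measure_pmf.prob v A) = - real (L A) - log 2 K"
        using K by (simp add: prob_v[OF A(1)] log_divide log_nat_power)
      moreover have "log 2 K \<le> 0" using K w by simp
      ultimately have "- log 2 (measure_pmf.prob v A) \<le> real (L A)" by simp
      then have "measure_pmf.prob m A * - log 2 (measure_pmf.prob v A)
          \<le> measure_pmf.prob m A * real (L A)"
        by (intro mult_left_mono) auto
      then show "0 < measure_pmf.prob v A \<and> - (measure_pmf.prob m A * log 2 (measure_pmf.prob v A))
          \<le> measure_pmf.prob m A * real (L A)"
        using K prob_v[OF A(1)] by simp
    qed auto
    ultimately show ?thesis by simp
  qed
  then show ?thesis using v(1) Y unfolding P_def by blast
qed

text \<open>Each block is represented by its centre, and the centre's codeword length is governed by
  the mass that \<open>v\<close> gives the block. Of the 3 bits, 2 come from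
  \<open>ex_prefix_code\<close> and 1 from halving the weights in the mixture
  \<open>q\<close>.\<close>

lemma ex_code_expected_length_le:
  fixes P :: "'a::countable list set set"
  assumes P: "P \<in> admissible_partitions \<rho> n d" and v: "set_pmf v \<subseteq> words n"
  shows "\<exists>\<xi>. semifaithful_code \<rho> d n \<xi> \<and> (\<forall>m. set_pmf m \<subseteq> words n \<longrightarrow>
    expected_length \<xi> m \<le> restricted_entropy P m + restricted_divergence P m v + 3)"
proof -
  have part: "partition_on (words n) P" using P by (simp add: admissible_partitions_def)
  have "\<forall>A\<in>P. \<exists>y\<in>A. \<forall>x\<in>A. word_distortion \<rho> n x y \<le> d"
    using P by (auto simp: admissible_partitions_def SUP_le_iff)
  then obtain center where center:
    "\<And>A. A \<in> P \<Longrightarrow> center A \<in> A" "\<And>A x. A \<in> P \<Longrightarrow> x \<in> A \<Longrightarrow> word_distortion \<rho> n x (center A) \<le> d"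
    by metis
  have "\<forall>x\<in>words n. \<exists>A\<in>P. x \<in> A" using part by (auto simp: partition_on_def)
  then obtain block where block: "\<And>x. x \<in> words n \<Longrightarrow> block x \<in> P" "\<And>x. x \<in> words n \<Longrightarrow> x \<in> block x"
    by metis
  have sub: "x \<in> words n" if "A \<in> P" "x \<in> A" for A x using that part by (auto simp: partition_on_def)
  have block_eq: "block x = A" if "A \<in> P" "x \<in> A" for A x
    using part block sub that unfolding partition_on_def disjoint_def by blast
  define Q where "Q x = center (block x)" for x
  have Q_eq: "Q x = center A" if "A \<in> P" "x \<in> A" for A x using block_eq[OF that] by (simp add: Q_def)
  define V where "V = map_pmf (\<lambda>x. to_nat (Q x)) v"
  \<comment> \<open>The geometric part makes every weight positive, so indices outside the support
    of \<open>V\<close> get codewords too; the factor 1/2 keeps the total at most 1.\<close>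
  define q :: "nat \<Rightarrow> real" where "q i = (pmf V i + (1/2) ^ Suc i) / 2" for i
  have "(\<Sum>i<k. q i) \<le> 1" for k
  proof -
    have "(\<Sum>i<k. pmf V i) \<le> 1"
      using measure_measure_pmf_finite[of "{..<k}" V] by (metis finite_lessThan measure_pmf.prob_le_1)
    moreover have "(\<Sum>i<k. (1/2::real) ^ Suc i) = 1 - (1/2) ^ k" by (induction k) auto
    then have "(\<Sum>i<k. (1/2::real) ^ Suc i) \<le> 1" by simp
    ultimately show ?thesis
      unfolding q_def sum_divide_distrib[symmetric] sum.distrib by simp
  qed
  moreover have q_pos: "q i > 0" for i unfolding q_def by (intro divide_pos_pos add_nonneg_pos) auto
  ultimately obtain c :: "nat \<Rightarrow> bool list" where c: "\<And>i. c i \<noteq> []"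
    "\<And>i j. i \<noteq> j \<Longrightarrow> \<not> prefix (c i) (c j)" "\<And>i. real (length (c i)) \<le> - log 2 (q i) + 2"
    using ex_prefix_code[of q] by auto
  define Y where "Y = Q ` words n"
  \<comment> \<open>A decoder must return a codebook element for every string, so strings that are
    not codewords are sent to an arbitrary one.\<close>
  define dec where "dec s = (SOME y. y \<in> Y \<and> ((\<exists>y'\<in>Y. c (to_nat y') = s) \<longrightarrow> c (to_nat y) = s))" for s
  define \<xi> where "\<xi> = \<lparr>quantizer = Q, encoder = \<lambda>y. c (to_nat y), decoder = dec\<rparr>"
  have "replicate n undefined \<in> words n" by (simp add: words_def)
  then have "Y \<noteq> {}" unfolding Y_def by blast
  then have "\<exists>y. y \<in> Y \<and> ((\<exists>y'\<in>Y. c (to_nat y') = s) \<longrightarrow> c (to_nat y) = s)" for s by blast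
  then have dec: "dec s \<in> Y \<and> ((\<exists>y'\<in>Y. c (to_nat y') = s) \<longrightarrow> c (to_nat (dec s)) = s)" for s
    unfolding dec_def by (rule someI_ex)
  have c_inj: "c (to_nat y) = c (to_nat y') \<Longrightarrow> y = y'" for y y' :: "'a list"
    using c(2)[of "to_nat y" "to_nat y'"] by (metis prefix_order.order_refl to_nat_split)
  have Q_words: "Q x \<in> words n" "Q (Q x) = Q x" if "x \<in> words n" for x
    using Q_eq block center sub that by (metis, metis)
  have dec_c: "dec (c (to_nat (Q x))) = Q x" if "x \<in> words n" for x
    using dec c_inj that unfolding Y_def by blast
  have book: "codebook n \<xi> = Y" by (simp add: codebook_def \<xi>_def Y_def)
  have "semifaithful_code \<rho> d n \<xi>"
    unfolding semifaithful_code_def book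
    using Q_words c(1,2) dec_c dec block center
    by (auto simp: \<xi>_def Y_def Q_def)
  moreover have "expected_length \<xi> m \<le> restricted_entropy P m + restricted_divergence P m v + 3"
    if m: "set_pmf m \<subseteq> words n" for m
  proof -
    define L where "L A = length (c (to_nat (center A)))" for A
    have "expected_length \<xi> m = (\<Sum>\<^sub>\<infinity>A\<in>P. ereal (measure_pmf.prob m A * real (L A)))"
      unfolding expected_length_def
      by (rule nn_integral_blocks[OF part m]) (simp add: L_def \<xi>_def Q_eq)
    also have "\<dots> \<le> restricted_entropy P m + restricted_divergence P m v + ereal 3"
      unfolding restricted_entropy_def restricted_divergence_def
    proof (rule le_entropy_plus_divergence)
      show "(measure_pmf.prob m has_sum 1) P" "(measure_pmf.prob v has_sum 1) P"
        using part m v by (auto intro: has_sum_prob_blocks)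
      fix A assume A: "A \<in> P" "measure_pmf.prob v A > 0"
      have "A \<subseteq> (\<lambda>x. to_nat (Q x)) -` {to_nat (center A)}" using Q_eq[OF A(1)] by auto
      then have "measure_pmf.prob v A \<le> pmf V (to_nat (center A))"
        unfolding V_def pmf_map by (intro measure_pmf.finite_measure_mono) auto
      also have "\<dots> \<le> 2 * q (to_nat (center A))" by (simp add: q_def)
      finally have "log 2 (measure_pmf.prob v A) \<le> log 2 (2 * q (to_nat (center A)))"
        using A(2) q_pos by simp
      also have "\<dots> = 1 + log 2 (q (to_nat (center A)))" 
        using q_pos[of "to_nat (center A)"] by (simp add: log_mult)
      finally have "real (L A) \<le> - log 2 (measure_pmf.prob v A) + 3"
        using c(3)[of "to_nat (center A)"] by (simp add: L_def)
      then have "measure_pmf.prob m A * real (L A)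
          \<le> measure_pmf.prob m A * (- log 2 (measure_pmf.prob v A) + 3)"
        by (intro mult_left_mono) auto
      then show "measure_pmf.prob m A * real (L A)
          \<le> - (measure_pmf.prob m A * log 2 (measure_pmf.prob v A)) + 3 * measure_pmf.prob m A"
        by (simp add: algebra_simps)
    qed auto
    finally show ?thesis by simp
  qed
  ultimately show ?thesis by blast
qed

section \<open>Scaling by a positive real in the extended reals\<close>

lemma ereal_mult_diff_distrib: "c > 0 \<Longrightarrow> ereal c * a - ereal c * b = ereal c * (a - b)"
  by (cases a; cases b) (auto simp: algebra_simps)

lemma diff_defined_mult_iff:
  "c > 0 \<Longrightarrow> diff_defined (ereal c * a) (ereal c * b) \<longleftrightarrow> diff_defined a b"
  unfolding diff_defined_def by (cases a; cases b) auto

lemma mono_ereal_mult: "c > 0 \<Longrightarrow> mono (\<lambda>x. ereal c * x)"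
  by (intro monoI ereal_mult_left_mono) auto

lemma bij_ereal_mult:
  assumes "c > 0"
  shows "bij (\<lambda>x. ereal c * x)"
proof (rule o_bij)
  have "ereal (1 / c) * (ereal c * x) = x \<and> ereal c * (ereal (1 / c) * x) = x" for x
    using assms by (cases x) auto
  then show "(\<lambda>x. ereal (1 / c) * x) \<circ> (\<lambda>x. ereal c * x) = id"
    and "(\<lambda>x. ereal c * x) \<circ> (\<lambda>x. ereal (1 / c) * x) = id" by auto
qed

lemma ereal_mult_SUP:
  assumes "c > 0"
  shows "(SUP x\<in>A. ereal c * f x) = ereal c * (SUP x\<in>A. f x)"
  using assms Sup_ereal_mult_left'[of A c f] by (cases "A = {}") (auto simp: bot_ereal_def)

text \<open>Scaling by a positive real is an order automorphism of the extended reals and therefore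
  preserves arbitrary infima.\<close>

lemma ereal_mult_INF:
  assumes "c > 0"
  shows "(INF x\<in>A. ereal c * f x) = ereal c * (INF x\<in>A. f x)"
  using mono_bij_Inf[OF mono_ereal_mult bij_ereal_mult, OF assms assms, of "f ` A"]
  by (simp add: image_comp comp_def)

section \<open>Redundancy bounds at a fixed block length\<close>

abbreviation (input) optimal_entropy ::
  "('a \<Rightarrow> 'a \<Rightarrow> real) \<Rightarrow> nat \<Rightarrow> real \<Rightarrow> 'a list pmf \<Rightarrow> ereal" where
  "optimal_entropy \<rho> n d m \<equiv> INF P\<in>admissible_partitions \<rho> n d. restricted_entropy P m"

lemma optimal_entropy_nonneg: "set_pmf m \<subseteq> words n \<Longrightarrow> 0 \<le> optimal_entropy \<rho> n d m"
  by (rule INF_greatest) (auto simp: admissible_partitions_def intro: restricted_entropy_nonneg)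

lemma optimal_entropy_le:
  "P \<in> admissible_partitions \<rho> n d \<Longrightarrow> optimal_entropy \<rho> n d m \<le> restricted_entropy P m"
  by (rule INF_lower)

text \<open>The witness \<open>m\<close> rules out the empty family, whose supremum is
  -\<infinity>.\<close>

lemma projected_radius_nonneg:
  fixes P :: "'a list set set"
  assumes "partition_on (words n) P" "m \<in> M" "set_pmf m \<subseteq> words n"
  shows "0 \<le> projected_radius n M P"
  unfolding projected_radius_def
proof (rule INF_greatest)
  fix v :: "'a list pmf" assume "v \<in> {v. set_pmf v \<subseteq> words n}"
  then have "0 \<le> restricted_divergence P m v"
    using assms by (intro restricted_divergence_nonneg) auto
  also have "\<dots> \<le> (SUP m\<in>M. restricted_divergence P m v)" using assms(2) by (rule SUP_upper)
  finally show "0 \<le> (SUP m\<in>M. restricted_divergence P m v)" .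
qed

lemma SUP_entropy_diff_nonneg:
  assumes "P \<in> admissible_partitions \<rho> n d" "m \<in> M"
  shows "0 \<le> (SUP m\<in>M. restricted_entropy P m - optimal_entropy \<rho> n d m)"
proof -
  have "0 \<le> restricted_entropy P m - optimal_entropy \<rho> n d m"
    using optimal_entropy_le[OF assms(1)] by (rule ereal_diff_positive)
  also have "\<dots> \<le> (SUP m\<in>M. restricted_entropy P m - optimal_entropy \<rho> n d m)"
    using assms(2) by (rule SUP_upper)
  finally show ?thesis .
qed

text \<open>Supplies the lower half of the sandwich for the code: the quantizer partition competes
  in the infimum, and the divergence is nonnegative.\<close>

lemma redundancy_nonneg:
  assumes \<xi>: "semifaithful_code \<rho> d n \<xi>" and m: "m \<in> M" "set_pmf m \<subseteq> words n"
  shows "0 \<le> (SUP m\<in>M. expected_length \<xi> m - optimal_entropy \<rho> n d m)"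
proof -
  let ?P = "quantizer_partition n \<xi>"
  obtain v where v: "set_pmf v \<subseteq> words n"
    "restricted_entropy ?P m + restricted_divergence ?P m v \<le> expected_length \<xi> m"
    using entropy_plus_divergence_le_expected_length[OF \<xi>] m by blast
  have "optimal_entropy \<rho> n d m \<le> restricted_entropy ?P m"
    by (intro optimal_entropy_le quantizer_partition_admissible \<xi>)
  also have "\<dots> \<le> restricted_entropy ?P m + restricted_divergence ?P m v"
    using restricted_divergence_nonneg[OF partition_on_quantizer_partition m(2) v(1)]
    by (simp add: ereal_le_add_self)
  also note v(2)
  finally have "0 \<le> expected_length \<xi> m - optimal_entropy \<rho> n d m" by (rule ereal_diff_positive)
  also have "\<dots> \<le> (SUP m\<in>M. expected_length \<xi> m - optimal_entropy \<rho> n d m)"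
    using m(1) by (rule SUP_upper)
  finally show ?thesis .
qed

text \<open>For each source the redundancy dominates the sum of two nonnegative quantities, entropy
  excess and divergence, hence each of them. The premises on \<open>diff_defined\<close> and the
  supremum make all quantities real, so the subtraction is legitimate.\<close>

lemma quantizer_partition_le_redundancy:
  assumes \<xi>: "semifaithful_code \<rho> d n \<xi>" and M: "\<And>m. m \<in> M \<Longrightarrow> set_pmf m \<subseteq> words n"
    and def: "\<And>m. m \<in> M \<Longrightarrow> diff_defined (expected_length \<xi> m) (optimal_entropy \<rho> n d m)"
    and fin: "(SUP m\<in>M. expected_length \<xi> m - optimal_entropy \<rho> n d m) < \<infinity>" (is "?S < _")
  defines "P \<equiv> quantizer_partition n \<xi>"
  shows "projected_radius n M P \<le> ?S"
    and "\<And>m. m \<in> M \<Longrightarrow> diff_defined (restricted_entropy P m) (optimal_entropy \<rho> n d m)"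
    and "(SUP m\<in>M. restricted_entropy P m - optimal_entropy \<rho> n d m) \<le> ?S"
proof -
  obtain v where v: "set_pmf v \<subseteq> words n"
    "\<And>m. set_pmf m \<subseteq> words n \<Longrightarrow>
      restricted_entropy P m + restricted_divergence P m v \<le> expected_length \<xi> m"
    using entropy_plus_divergence_le_expected_length[OF \<xi>] unfolding P_def by blast
  have part: "partition_on (words n) P"
    unfolding P_def by (rule partition_on_quantizer_partition)
  have key: "restricted_divergence P m v \<le> expected_length \<xi> m - optimal_entropy \<rho> n d m \<and>
      diff_defined (restricted_entropy P m) (optimal_entropy \<rho> n d m) \<and>
      restricted_entropy P m - optimal_entropy \<rho> n d m
        \<le> expected_length \<xi> m - optimal_entropy \<rho> n d m" if m: "m \<in> M" for m
  proof -
    have "expected_length \<xi> m - optimal_entropy \<rho> n d m \<le> ?S" using m by (rule SUP_upper)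
    then have "expected_length \<xi> m - optimal_entropy \<rho> n d m \<noteq> \<infinity>" using fin by auto
    \<comment> \<open>An infinite length would, by \<open>diff_defined\<close>, meet a subtrahend
      other than \<infinity>, and the difference would be \<infinity>.\<close>
    then have "expected_length \<xi> m \<noteq> \<infinity>"
      using def[OF m] by (auto simp: diff_defined_def)
    moreover have D: "0 \<le> restricted_divergence P m v"
      by (rule restricted_divergence_nonneg[OF part M[OF m] v(1)])
    moreover have I: "0 \<le> optimal_entropy \<rho> n d m" by (rule optimal_entropy_nonneg[OF M[OF m]])
    moreover have IH: "optimal_entropy \<rho> n d m \<le> restricted_entropy P m"
      unfolding P_def by (intro optimal_entropy_le quantizer_partition_admissible \<xi>)
    moreover have HD: "restricted_entropy P m + restricted_divergence P m v \<le> expected_length \<xi> m"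
      by (rule v(2)[OF M[OF m]])
    ultimately have "restricted_entropy P m \<noteq> \<infinity>" "restricted_divergence P m v \<noteq> \<infinity>"
      by auto
    moreover have "restricted_entropy P m \<ge> 0" using I IH by (rule order_trans)
    ultimately obtain h s where eq: "restricted_entropy P m = ereal h"
      "restricted_divergence P m v = ereal s"
      using D by (cases "restricted_entropy P m"; cases "restricted_divergence P m v") auto
    moreover obtain i where "optimal_entropy \<rho> n d m = ereal i"
      using I IH eq by (cases "optimal_entropy \<rho> n d m") auto
    ultimately show ?thesis
      using D IH HD by (cases "expected_length \<xi> m") (auto simp: diff_defined_def)
  qed
  have "projected_radius n M P \<le> (SUP m\<in>M. restricted_divergence P m v)"
    unfolding projected_radius_def using v(1) by (intro INF_lower) simp
  also have "\<dots> \<le> ?S" using key by (intro SUP_mono) blast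
  finally show "projected_radius n M P \<le> ?S" .
  show "\<And>m. m \<in> M \<Longrightarrow> diff_defined (restricted_entropy P m) (optimal_entropy \<rho> n d m)"
    using key by blast
  show "(SUP m\<in>M. restricted_entropy P m - optimal_entropy \<rho> n d m) \<le> ?S"
    using key by (intro SUP_mono) blast
qed

lemma ex_code_redundancy_le:
  fixes P :: "'a::countable list set set"
  assumes P: "P \<in> admissible_partitions \<rho> n d" and M: "\<And>m. m \<in> M \<Longrightarrow> set_pmf m \<subseteq> words n"
    and M_ne: "M \<noteq> {}"
  shows "\<exists>\<xi>. semifaithful_code \<rho> d n \<xi> \<and>
    ((\<forall>m\<in>M. diff_defined (restricted_entropy P m) (optimal_entropy \<rho> n d m)) \<and>
     projected_radius n M P < \<infinity> \<and>
     (SUP m\<in>M. restricted_entropy P m - optimal_entropy \<rho> n d m) < \<infinity> \<longrightarrow>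
     (\<forall>m\<in>M. diff_defined (expected_length \<xi> m) (optimal_entropy \<rho> n d m)) \<and>
     (SUP m\<in>M. expected_length \<xi> m - optimal_entropy \<rho> n d m)
       \<le> (SUP m\<in>M. restricted_entropy P m - optimal_entropy \<rho> n d m) + projected_radius n M P + 4)"
    (is "\<exists>\<xi>. _ \<and> (?def \<and> ?R < \<infinity> \<and> ?T < \<infinity> \<longrightarrow> _)")
proof -
  have part: "partition_on (words n) P" using P by (simp add: admissible_partitions_def)
  obtain m0 where "m0 \<in> M" using M_ne by blast
  then have R_nn: "0 \<le> ?R" using part M by (intro projected_radius_nonneg)
  \<comment> \<open>The infimum over \<open>v\<close> may not be attained; a margin of 1 gives a
    near-minimizer valid for the whole family at once. If the radius is infinite, a point mass fills
    in.\<close>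
  have "\<exists>v. set_pmf v \<subseteq> words n \<and> (?R < \<infinity> \<longrightarrow> (\<forall>m\<in>M. restricted_divergence P m v \<le> ?R + 1))"
  proof (cases "?R < \<infinity>")
    case True
    then have "?R < ?R + 1" using R_nn by (cases ?R) (auto simp: one_ereal_def)
    then obtain v where "set_pmf v \<subseteq> words n" "(SUP m\<in>M. restricted_divergence P m v) < ?R + 1"
      unfolding projected_radius_def INF_less_iff by blast
    then show ?thesis by (meson SUP_upper less_imp_le order_trans)
  next
    case False
    have "set_pmf (return_pmf (replicate n undefined)) \<subseteq> words n" by (simp add: words_def)
    then show ?thesis using False by blast
  qed
  then obtain v where v: "set_pmf v \<subseteq> words n"
    "\<And>m. ?R < \<infinity> \<Longrightarrow> m \<in> M \<Longrightarrow> restricted_divergence P m v \<le> ?R + 1" by blast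
  obtain \<xi> where \<xi>: "semifaithful_code \<rho> d n \<xi>"
    "\<And>m. set_pmf m \<subseteq> words n \<Longrightarrow>
      expected_length \<xi> m \<le> restricted_entropy P m + restricted_divergence P m v + 3"
    using ex_code_expected_length_le[OF P v(1)] by blast
  have "(\<forall>m\<in>M. diff_defined (expected_length \<xi> m) (optimal_entropy \<rho> n d m)) \<and>
     (SUP m\<in>M. expected_length \<xi> m - optimal_entropy \<rho> n d m) \<le> ?T + ?R + 4"
    if def: ?def and fin: "?R < \<infinity>" "?T < \<infinity>"
  proof -
    have key: "diff_defined (expected_length \<xi> m) (optimal_entropy \<rho> n d m) \<and>
       expected_length \<xi> m - optimal_entropy \<rho> n d m \<le> ?T + ?R + 4" if m: "m \<in> M" for m
    proof -
      have T: "restricted_entropy P m - optimal_entropy \<rho> n d m \<le> ?T" using m by (rule SUP_upper)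
      then have "restricted_entropy P m - optimal_entropy \<rho> n d m \<noteq> \<infinity>" using fin by auto
      then have H: "restricted_entropy P m \<noteq> \<infinity>" using def m by (auto simp: diff_defined_def)
      have I: "0 \<le> optimal_entropy \<rho> n d m" by (rule optimal_entropy_nonneg[OF M[OF m]])
      have IH: "optimal_entropy \<rho> n d m \<le> restricted_entropy P m" by (rule optimal_entropy_le[OF P])
      have D: "0 \<le> restricted_divergence P m v"
        by (rule restricted_divergence_nonneg[OF part M[OF m] v(1)])
      have N: "0 \<le> expected_length \<xi> m" by (simp add: expected_length_def)
      obtain h i r s :: real where eq: "restricted_entropy P m = ereal h"
        "optimal_entropy \<rho> n d m = ereal i" "?R = ereal r" "restricted_divergence P m v = ereal s"
        using H I IH D R_nn fin(1) v(2)[OF fin(1) m]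
        by (cases "restricted_entropy P m"; cases "optimal_entropy \<rho> n d m"; cases ?R;
            cases "restricted_divergence P m v") (auto simp: one_ereal_def)
      have "expected_length \<xi> m \<le> ereal (h + s + 3)"
        using \<xi>(2)[OF M[OF m]] eq by simp
      then obtain l where l: "expected_length \<xi> m = ereal l" "l \<le> h + s + 3"
        using N by (cases "expected_length \<xi> m") auto
      have "s \<le> r + 1" using v(2)[OF fin(1) m] eq by (simp add: one_ereal_def)
      then have "ereal (l - i) \<le> ereal (h - i) + ereal r + 4" using l by simp
      also have "\<dots> \<le> ?T + ?R + 4" using T eq by (intro add_right_mono add_mono) simp_all
      finally show ?thesis using eq l by (simp add: diff_defined_def)
    qed
    then show ?thesis by (auto intro: SUP_least)
  qed
  then show ?thesis using \<xi>(1) by blast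
qed

section \<open>Passage to the limit and the equivalence\<close>

lemma set_product_family: "m \<in> product_family n \<Lambda> \<Longrightarrow> set_pmf m \<subseteq> words n"
  by (auto simp: product_family_def set_replicate_pmf words_def)

lemma operational_rate_eq:
  "n \<ge> 1 \<Longrightarrow> operational_rate \<rho> n d m = ereal (1 / real n) * optimal_entropy \<rho> n d m"
  unfolding operational_rate_def by (intro ereal_mult_INF) simp

text \<open>Pulls the factor \<open>1 / real n\<close> out of supremum and infimum. At n = 0 that
  factor is 0 and cannot be cancelled, hence the comparison for n \<ge> 1 only.\<close>

lemma strongly_minimax_universal_iff:
  "strongly_minimax_universal \<rho> d \<Lambda> \<xi> \<longleftrightarrow>
     (\<forall>\<^sub>F n in sequentially. \<forall>m\<in>product_family n \<Lambda>.
        diff_defined (expected_length (\<xi> n) m) (optimal_entropy \<rho> n d m)) \<and>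
     (\<lambda>n. ereal (1 / real n) *
       (SUP m\<in>product_family n \<Lambda>. expected_length (\<xi> n) m - optimal_entropy \<rho> n d m)) \<longlonglongrightarrow> 0"
proof -
  have rate: "rate n (\<xi> n) m = ereal (1 / real n) * expected_length (\<xi> n) m" for n m
    by (simp add: rate_def expected_length_def)
  have "(\<forall>\<^sub>F n in sequentially. \<forall>\<mu>\<in>\<Lambda>. diff_defined (rate n (\<xi> n) (replicate_pmf n \<mu>))
            (operational_rate \<rho> n d (replicate_pmf n \<mu>))) \<longleftrightarrow>
        (\<forall>\<^sub>F n in sequentially. \<forall>m\<in>product_family n \<Lambda>.
            diff_defined (expected_length (\<xi> n) m) (optimal_entropy \<rho> n d m))"
    by (rule eventually_cong[OF eventually_ge_at_top[of 1]])
      (simp add: rate operational_rate_eq diff_defined_mult_iff product_family_def)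
  moreover have "(\<lambda>n. SUP \<mu>\<in>\<Lambda>. rate n (\<xi> n) (replicate_pmf n \<mu>)
                    - operational_rate \<rho> n d (replicate_pmf n \<mu>)) \<longlonglongrightarrow> 0 \<longleftrightarrow>
     (\<lambda>n. ereal (1 / real n) *
       (SUP m\<in>product_family n \<Lambda>. expected_length (\<xi> n) m - optimal_entropy \<rho> n d m)) \<longlonglongrightarrow> 0"
    by (rule tendsto_cong, rule eventually_mono[OF eventually_ge_at_top[of 1]])
      (simp add: rate operational_rate_eq ereal_mult_diff_distrib ereal_mult_SUP
        product_family_def image_comp comp_def)
  ultimately show ?thesis unfolding strongly_minimax_universal_def by simp
qed

text \<open>A positive multiple of \<infinity> is \<infinity>, which cannot stay below 1. This turns
  the limits into the finiteness premises of the bounds at fixed n.\<close>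

lemma eventually_less_top_of_tendsto_0:
  assumes "(\<lambda>n. ereal (1 / real n) * f n) \<longlonglongrightarrow> 0"
  shows "\<forall>\<^sub>F n in sequentially. f n < \<infinity>"
proof -
  have "\<forall>\<^sub>F n in sequentially. ereal (1 / real n) * f n < 1"
    using assms by (rule order_tendstoD) simp
  then show ?thesis
    using eventually_ge_at_top[of 1] by eventually_elim (auto simp: less_top[symmetric])
qed

theorem theorem2:
  fixes \<rho> :: "'a::countable \<Rightarrow> 'a \<Rightarrow> real" and \<Lambda> :: "'a pmf set" and d :: real
  assumes "infinite (UNIV :: 'a set)"
    and "\<And>x y. \<rho> x y \<ge> 0"
    and "\<And>x y. y \<noteq> x \<Longrightarrow> \<rho> x y > 0"
    and "d > 0"
  shows "(\<exists>\<xi>. semifaithful_scheme \<rho> d \<xi> \<and> strongly_minimax_universal \<rho> d \<Lambda> \<xi>) \<longleftrightarrow>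
    (\<exists>\<pi>. (\<forall>n\<ge>1. partition_on (words n) (\<pi> n)) \<and>
      (\<forall>n\<ge>1. \<pi> n \<in> admissible_partitions \<rho> n d) \<and>
      (\<lambda>n. ereal (1 / real n) * projected_radius n (product_family n \<Lambda>) (\<pi> n)) \<longlonglongrightarrow> 0 \<and>
      (\<forall>\<^sub>F n in sequentially. \<forall>m\<in>product_family n \<Lambda>.
         diff_defined (restricted_entropy (\<pi> n) m)
                      (INF P\<in>admissible_partitions \<rho> n d. restricted_entropy P m)) \<and>
      (\<lambda>n. ereal (1 / real n) *
         (SUP m\<in>product_family n \<Lambda>. restricted_entropy (\<pi> n) m
            - (INF P\<in>admissible_partitions \<rho> n d. restricted_entropy P m))) \<longlonglongrightarrow> 0)"
    (is "?L \<longleftrightarrow> ?R")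
proof (cases "\<Lambda> = {}")
  case True
  \<comment> \<open>Without sources the suprema are -\<infinity>, so both sides of the equivalence
    fail.\<close>
  have "\<not> (\<lambda>n. ereal (1 / real n) * (SUP m\<in>{}. f n m)) \<longlonglongrightarrow> 0"
    for f :: "nat \<Rightarrow> 'a list pmf \<Rightarrow> ereal"
  proof
    assume *: "(\<lambda>n. ereal (1 / real n) * (SUP m\<in>{}. f n m)) \<longlonglongrightarrow> 0"
    have "\<forall>\<^sub>F n in sequentially. ereal (1 / real n) * (SUP m\<in>{}. f n m) = -\<infinity>"
      using eventually_ge_at_top[of 1] by eventually_elim (simp add: bot_ereal_def)
    from tendsto_cong[THEN iffD1, OF this *] show False
      by (simp add: tendsto_const_iff)
  qed
  then show ?thesis
    unfolding strongly_minimax_universal_iff using True by (simp add: product_family_def)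
next
  case False
  define M where "M n = product_family n \<Lambda>" for n
  have M: "set_pmf m \<subseteq> words n" if "m \<in> M n" for m n
    using that unfolding M_def by (rule set_product_family)
  have M_ne: "M n \<noteq> {}" for n using False by (simp add: M_def product_family_def)
  then have "\<exists>m. m \<in> M n" for n by blast
  then obtain m0 where m0: "\<And>n. m0 n \<in> M n" by metis
  have c_nn: "0 \<le> ereal (1 / real n)" for n by simp
  show ?thesis
  proof
    assume ?L
    then obtain \<xi> where scheme: "semifaithful_scheme \<rho> d \<xi>"
      and universal: "strongly_minimax_universal \<rho> d \<Lambda> \<xi>" by blast
    have \<xi>: "semifaithful_code \<rho> d n (\<xi> n)" if "n \<ge> 1" for n
      using scheme that by (simp add: semifaithful_scheme_def)
    have def: "\<forall>\<^sub>F n in sequentially. \<forall>m\<in>M n.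
        diff_defined (expected_length (\<xi> n) m) (optimal_entropy \<rho> n d m)"
      and lim: "(\<lambda>n. ereal (1 / real n) *
        (SUP m\<in>M n. expected_length (\<xi> n) m - optimal_entropy \<rho> n d m)) \<longlonglongrightarrow> 0"
      unfolding M_def
      by (rule universal[unfolded strongly_minimax_universal_iff, THEN conjunct1]
          universal[unfolded strongly_minimax_universal_iff, THEN conjunct2])+
    define \<pi> where "\<pi> n = quantizer_partition n (\<xi> n)" for n
    have part: "partition_on (words n) (\<pi> n)" for n
      unfolding \<pi>_def by (rule partition_on_quantizer_partition)
    have adm: "\<pi> n \<in> admissible_partitions \<rho> n d" if "n \<ge> 1" for n
      unfolding \<pi>_def by (intro quantizer_partition_admissible \<xi> that)
    have ev: "\<forall>\<^sub>F n in sequentially.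
        projected_radius n (M n) (\<pi> n)
          \<le> (SUP m\<in>M n. expected_length (\<xi> n) m - optimal_entropy \<rho> n d m) \<and>
        (\<forall>m\<in>M n. diff_defined (restricted_entropy (\<pi> n) m) (optimal_entropy \<rho> n d m)) \<and>
        (SUP m\<in>M n. restricted_entropy (\<pi> n) m - optimal_entropy \<rho> n d m)
          \<le> (SUP m\<in>M n. expected_length (\<xi> n) m - optimal_entropy \<rho> n d m)"
      using def eventually_less_top_of_tendsto_0[OF lim] eventually_ge_at_top[of 1]
    proof eventually_elim
      case (elim n)
      have def': "diff_defined (expected_length (\<xi> n) m) (optimal_entropy \<rho> n d m)"
        if "m \<in> M n" for m
        using elim(1) that by (rule bspec)
      note le = quantizer_partition_le_redundancy[of \<rho> d n "\<xi> n" "M n", OF \<xi>[OF elim(3)] M def' elim(2)]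
      show ?case unfolding \<pi>_def by (intro conjI ballI le)
    qed
    have radius: "(\<lambda>n. ereal (1 / real n) * projected_radius n (M n) (\<pi> n)) \<longlonglongrightarrow> 0"
    proof (rule tendsto_sandwich[OF _ _ tendsto_const lim])
      show "\<forall>\<^sub>F n in sequentially. 0 \<le> ereal (1 / real n) * projected_radius n (M n) (\<pi> n)"
        using projected_radius_nonneg[OF part m0 M[OF m0]] by (simp add: ereal_0_le_mult)
      show "\<forall>\<^sub>F n in sequentially. ereal (1 / real n) * projected_radius n (M n) (\<pi> n)
          \<le> ereal (1 / real n) * (SUP m\<in>M n. expected_length (\<xi> n) m - optimal_entropy \<rho> n d m)"
        using ev by eventually_elim (simp add: ereal_mult_left_mono)
    qed
    have excess: "(\<lambda>n. ereal (1 / real n) *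
        (SUP m\<in>M n. restricted_entropy (\<pi> n) m - optimal_entropy \<rho> n d m)) \<longlonglongrightarrow> 0"
    proof (rule tendsto_sandwich[OF _ _ tendsto_const lim])
      show "\<forall>\<^sub>F n in sequentially. 0 \<le> ereal (1 / real n) *
          (SUP m\<in>M n. restricted_entropy (\<pi> n) m - optimal_entropy \<rho> n d m)"
        using eventually_ge_at_top[of 1]
      proof eventually_elim
        case (elim n)
        then show ?case by (intro ereal_0_le_mult c_nn SUP_entropy_diff_nonneg[OF adm m0])
      qed
      show "\<forall>\<^sub>F n in sequentially. ereal (1 / real n) *
          (SUP m\<in>M n. restricted_entropy (\<pi> n) m - optimal_entropy \<rho> n d m)
          \<le> ereal (1 / real n) * (SUP m\<in>M n. expected_length (\<xi> n) m - optimal_entropy \<rho> n d m)"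
        using ev by eventually_elim (simp add: ereal_mult_left_mono)
    qed
    have "\<forall>\<^sub>F n in sequentially. \<forall>m\<in>M n.
        diff_defined (restricted_entropy (\<pi> n) m) (optimal_entropy \<rho> n d m)"
      using ev by eventually_elim (elim conjE)
    then show ?R
      using part adm radius excess unfolding M_def by (intro exI[of _ \<pi>] conjI allI impI)
  next
    assume ?R
    then obtain \<pi> where adm_all: "\<forall>n\<ge>1. \<pi> n \<in> admissible_partitions \<rho> n d"
      and radius': "(\<lambda>n. ereal (1 / real n) * projected_radius n (product_family n \<Lambda>) (\<pi> n)) \<longlonglongrightarrow> 0"
      and def': "\<forall>\<^sub>F n in sequentially. \<forall>m\<in>product_family n \<Lambda>.
        diff_defined (restricted_entropy (\<pi> n) m) (optimal_entropy \<rho> n d m)"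
      and excess': "(\<lambda>n. ereal (1 / real n) *
        (SUP m\<in>product_family n \<Lambda>. restricted_entropy (\<pi> n) m - optimal_entropy \<rho> n d m)) \<longlonglongrightarrow> 0"
      by (elim exE conjE) (rule that)
    note radius = radius'[folded M_def] and def = def'[folded M_def] and excess = excess'[folded M_def]
    have adm: "\<pi> n \<in> admissible_partitions \<rho> n d" if "n \<ge> 1" for n using adm_all that by blast
    define R where "R n = projected_radius n (M n) (\<pi> n)" for n
    define T where "T n = (SUP m\<in>M n. restricted_entropy (\<pi> n) m - optimal_entropy \<rho> n d m)" for n
    \<comment> \<open>As a conditional bound, \<open>good\<close> can be satisfied at every n \<ge>
      1, including the finitely many n where the premises fail, and so a whole scheme can be
      chosen.\<close>
    define good where "good n \<xi> \<longleftrightarrow> semifaithful_code \<rho> d n \<xi> \<and>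
      ((\<forall>m\<in>M n. diff_defined (restricted_entropy (\<pi> n) m) (optimal_entropy \<rho> n d m)) \<and>
       R n < \<infinity> \<and> T n < \<infinity> \<longrightarrow>
       (\<forall>m\<in>M n. diff_defined (expected_length \<xi> m) (optimal_entropy \<rho> n d m)) \<and>
       (SUP m\<in>M n. expected_length \<xi> m - optimal_entropy \<rho> n d m) \<le> T n + R n + 4)" for n \<xi>
    have "\<exists>\<xi>. good n \<xi>" if "n \<ge> 1" for n
      unfolding good_def R_def T_def by (rule ex_code_redundancy_le[OF adm[OF that] M M_ne])
    then obtain \<xi> where "\<And>n. n \<ge> 1 \<Longrightarrow> good n (\<xi> n)" by metis
    then have \<xi>: "semifaithful_code \<rho> d n (\<xi> n)"
      and bound: "\<forall>m\<in>M n. diff_defined (restricted_entropy (\<pi> n) m) (optimal_entropy \<rho> n d m) \<Longrightarrow>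
        R n < \<infinity> \<Longrightarrow> T n < \<infinity> \<Longrightarrow>
        (\<forall>m\<in>M n. diff_defined (expected_length (\<xi> n) m) (optimal_entropy \<rho> n d m)) \<and>
        (SUP m\<in>M n. expected_length (\<xi> n) m - optimal_entropy \<rho> n d m) \<le> T n + R n + 4"
      if "n \<ge> 1" for n
      using that unfolding good_def by simp_all
    have ev: "\<forall>\<^sub>F n in sequentially. n \<ge> 1 \<and>
        (\<forall>m\<in>M n. diff_defined (expected_length (\<xi> n) m) (optimal_entropy \<rho> n d m)) \<and>
        (SUP m\<in>M n. expected_length (\<xi> n) m - optimal_entropy \<rho> n d m) \<le> T n + R n + 4"
      using def eventually_less_top_of_tendsto_0[OF radius]
        eventually_less_top_of_tendsto_0[OF excess] eventually_ge_at_top[of 1]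
    proof eventually_elim
      case (elim n)
      show ?case using bound[OF elim(4,1)] elim(2-4) unfolding R_def T_def by simp
    qed
    have "(\<lambda>n. ereal (1 / real n * 4)) \<longlonglongrightarrow> ereal (0 * 4)"
      by (intro tendsto_intros lim_1_over_n)
    then have "(\<lambda>n. ereal (1 / real n) * 4) \<longlonglongrightarrow> 0" by (simp add: zero_ereal_def)
    then have "(\<lambda>n. (ereal (1 / real n) * T n + ereal (1 / real n) * R n) + ereal (1 / real n) * 4)
        \<longlonglongrightarrow> 0 + 0 + 0"
      using radius excess unfolding R_def T_def by (intro tendsto_add_ereal) auto
    then have lim: "(\<lambda>n. (ereal (1 / real n) * T n + ereal (1 / real n) * R n) + ereal (1 / real n) * 4)
        \<longlonglongrightarrow> 0" by simp
    have "(\<lambda>n. ereal (1 / real n) *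
        (SUP m\<in>M n. expected_length (\<xi> n) m - optimal_entropy \<rho> n d m)) \<longlonglongrightarrow> 0"
    proof (rule tendsto_sandwich[OF _ _ tendsto_const lim])
      show "\<forall>\<^sub>F n in sequentially. 0 \<le> ereal (1 / real n) *
          (SUP m\<in>M n. expected_length (\<xi> n) m - optimal_entropy \<rho> n d m)"
        using eventually_ge_at_top[of 1]
      proof eventually_elim
        case (elim n)
        then show ?case by (intro ereal_0_le_mult c_nn redundancy_nonneg[OF \<xi> m0 M[OF m0]])
      qed
      show "\<forall>\<^sub>F n in sequentially. ereal (1 / real n) *
          (SUP m\<in>M n. expected_length (\<xi> n) m - optimal_entropy \<rho> n d m)
          \<le> (ereal (1 / real n) * T n + ereal (1 / real n) * R n) + ereal (1 / real n) * 4"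
        using ev
      proof eventually_elim
        case (elim n)
        \<comment> \<open>Distributing the factor over an extended-real sum uses that the summands
          are nonnegative.\<close>
        have "0 \<le> T n" unfolding T_def using elim by (intro SUP_entropy_diff_nonneg[OF adm m0]) simp
        moreover have "0 \<le> R n"
          unfolding R_def using adm[of n] elim m0 M[OF m0]
          by (intro projected_radius_nonneg) (auto simp: admissible_partitions_def)
        ultimately have eq: "ereal (1 / real n) * (T n + R n + 4) =
            (ereal (1 / real n) * T n + ereal (1 / real n) * R n) + ereal (1 / real n) * 4"
          by (simp add: ereal_right_distrib)
        show ?case
          unfolding eq[symmetric] by (intro ereal_mult_left_mono c_nn) (use elim in blast)
      qed
    qed
    moreover have "\<forall>\<^sub>F n in sequentially. \<forall>m\<in>M n.
        diff_defined (expected_length (\<xi> n) m) (optimal_entropy \<rho> n d m)"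
      using ev by eventually_elim (elim conjE)
    ultimately show ?L
      using \<xi> unfolding semifaithful_scheme_def strongly_minimax_universal_iff M_def
      by (intro exI[of _ \<xi>] conjI allI impI)
  qed
qed

end
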